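(* Let $D=(V,A)$ be a directed graph with $n=|V|$ and $m=|A|$, $s,t\in V$, $c:A\to\mathbb{R}_{\geq 0}$, and let $p$ be a given shortest $s$-$t$-path with respect to $c$ having $\ell$ arcs. The algorithm $\text{BDA}_{2\text{SSP}}$ applied to the biobjective instance $(D,s,t,\gamma_p)$ with input $\ell$ uses $\mathcal{O}(n\ell+n+m)\subseteq\mathcal{O}(n^2+m)$ memory.
   Context: $\gamma_p:A\to\mathbb{R}^2_{\geq0}$ is defined by $\gamma_{p,1}(a)=c(a)$, and $\gamma_{p,2}(a)=1$ if $a$ lies on $p$ and $0$ otherwise; path costs are sums of arc costs. The One-to-One Biobjective Dijkstra Algorithm (BDA) computes a minimum complete set of efficient (Pareto-optimal w.r.t. $\gamma_p$) $s$-$v$-paths by extracting candidate paths from a priority queue in lexicographically nondecreasing order of $\gamma_p$, keeping at most one candidate per node in the queue and, after a path to $v$ is made permanent, rebuilding the next candidate for each out-neighbour from the permanent efficient paths of its in-neighbours; weakly dominated paths are discarded. $\text{BDA}_{2\text{SSP}}$ is this algorithm modified to stop as soon as it extracts an efficient $s$-$t$-path $q$ with $\gamma_{p,2}(q)<\ell$ (returning the suffix of $q$ after its first deviation from $p$), or when the priority queue is empty (returning a dummy path). *)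

theory Defs
  imports
    "Graph_Theory.Shortest_Path"
    "HOL-Library.Sublist"
    "HOL-Library.Product_Plus"
    "HOL-Library.Extended_Nat"
    "HOL-Library.Landau_Symbols"
begin

text \<open>
  The order instances on pairs in \<^verbatim>\<open>HOL-Library\<close> (componentwise or lexicographic) exclude each
  other, and the algorithm needs both orders.
\<close>

definition weakly_dominates :: "real \<times> real \<Rightarrow> real \<times> real \<Rightarrow> bool" where
  "weakly_dominates x y \<longleftrightarrow> fst x \<le> fst y \<and> snd x \<le> snd y"

definition lex_less :: "real \<times> real \<Rightarrow> real \<times> real \<Rightarrow> bool" where
  "lex_less x y \<longleftrightarrow> fst x < fst y \<or> fst x = fst y \<and> snd x < snd y"

text \<open>
  A path is stored as a label: its cost vector and, unless it is the path without arcs, its last arc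
  \<open>a\<close> together with the position, in the list of permanent labels of the tail of \<open>a\<close>, of the label
  of the path without its last arc.
\<close>

datatype 'b label = Label (label_cost: "real \<times> real") (label_pred: "('b \<times> nat) option")

text \<open>
  The control state holds the local variables of the loop being executed.
  \<^item> \<open>Select\<close>: the queue is about to be inspected.
  \<^item> \<open>Rebuild ws\<close>: the candidates of the nodes \<open>ws\<close> are still to be rebuilt.
  \<^item> \<open>Scan w as b ws\<close>: the candidate of \<open>w\<close> is being rebuilt, the incoming arcs \<open>as\<close> are still to be
    scanned, and \<open>b\<close> is the best candidate found so far.
  \<^item> \<open>Trace x q\<close>: the arcs of the path found are being collected; \<open>q\<close> is the part collected so far
    and \<open>x\<close> is the label of the remaining initial part.
  \<^item> \<open>Done r\<close>: the algorithm has returned \<open>r\<close>, where \<open>None\<close> is the dummy path.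
\<close>

datatype ('a, 'b) control =
    Select
  | Rebuild "'a list"
  | Scan 'a "'b list" "'b label option" "'a list"
  | Trace "'b label" "'b list"
  | Done "'b list option"

text \<open>
  \<open>last_processed a\<close> is the first position in the list of permanent labels of the tail of \<open>a\<close> whose
  extension along \<open>a\<close> has not been discarded yet.
\<close>

record ('a, 'b) bda_state =
  permanent :: "'a \<Rightarrow> 'b label list"
  queue :: "('a \<times> 'b label) list"
  last_processed :: "'b \<Rightarrow> nat"
  control :: "('a, 'b) control"

fun better_candidate :: "'b label option \<Rightarrow> 'b label \<Rightarrow> 'b label option" where
  "better_candidate None y = Some y"
| "better_candidate (Some x) y =
    Some (if lex_less (label_cost y) (label_cost x) then y else x)"

definition replace_candidate ::
    "'a \<Rightarrow> 'b label option \<Rightarrow> ('a \<times> 'b label) list \<Rightarrow> ('a \<times> 'b label) list" where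
  "replace_candidate w b Q =
    (case b of None \<Rightarrow> [] | Some x \<Rightarrow> [(w, x)]) @ filter (\<lambda>e. fst e \<noteq> w) Q"

text \<open>
  The algorithm on the biobjective instance \<open>(D, s, t, \<gamma>)\<close> with input \<open>l\<close>. The path \<open>p\<close> is used only
  to cut off the common initial part from the path that is returned.

  Discarding paths weakly dominated by a permanent path with the same end node is part of the
  algorithm in any case; \<open>target_pruning\<close> says whether paths weakly dominated by a permanent
  \<open>s\<close>-\<open>t\<close>-path are discarded too.
\<close>

locale bda_2ssp =
  fixes D :: "('a, 'b) pre_digraph"
    and s t :: 'a
    and \<gamma> :: "'b \<Rightarrow> real \<times> real"
    and l :: nat
    and p :: "'b list"
    and target_pruning :: bool
begin

definition init :: "('a, 'b) bda_state" where
  "init = \<lparr>permanent = (\<lambda>_. []), queue = [(s, Label 0 None)], last_processed = (\<lambda>_. 0),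
     control = Select\<rparr>"

definition discarded :: "('a \<Rightarrow> 'b label list) \<Rightarrow> 'a \<Rightarrow> 'b label \<Rightarrow> bool" where
  "discarded P w y \<longleftrightarrow>
    (\<exists>x\<in>set (P w). weakly_dominates (label_cost x) (label_cost y)) \<or>
    target_pruning \<and> (\<exists>x\<in>set (P t). weakly_dominates (label_cost x) (label_cost y))"

definition extension :: "('a \<Rightarrow> 'b label list) \<Rightarrow> 'b \<Rightarrow> nat \<Rightarrow> 'b label" where
  "extension P a k = Label (label_cost (P (tail D a) ! k) + \<gamma> a) (Some (a, k))"

definition lex_min_in_queue :: "('a, 'b) bda_state \<Rightarrow> 'a \<Rightarrow> 'b label \<Rightarrow> bool" where
  "lex_min_in_queue \<sigma> v x \<longleftrightarrow> (v, x) \<in> set (queue \<sigma>) \<and>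
    (\<forall>(w, y)\<in>set (queue \<sigma>). \<not> lex_less (label_cost y) (label_cost x))"

text \<open>
  Ties in the queue and the order in which neighbours are visited are left open.
  In \<open>permanent\<close>, the candidate of \<open>v\<close> itself has just left the queue, so it is rebuilt along with
  those of the out-neighbours of \<open>v\<close>.
\<close>

inductive step :: "('a, 'b) bda_state \<Rightarrow> ('a, 'b) bda_state \<Rightarrow> bool" where
  empty_queue:
    "control \<sigma> = Select \<Longrightarrow> queue \<sigma> = [] \<Longrightarrow>
     step \<sigma> (\<sigma>\<lparr>control := Done None\<rparr>)"
| found:
    "control \<sigma> = Select \<Longrightarrow> lex_min_in_queue \<sigma> v x \<Longrightarrow>
     v = t \<and> snd (label_cost x) < real l \<Longrightarrow>
     step \<sigma> (\<sigma>\<lparr>queue := remove1 (v, x) (queue \<sigma>), control := Trace x []\<rparr>)"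
| permanent:
    "control \<sigma> = Select \<Longrightarrow> lex_min_in_queue \<sigma> v x \<Longrightarrow>
     \<not> (v = t \<and> snd (label_cost x) < real l) \<Longrightarrow>
     distinct ws \<Longrightarrow> set ws = insert v (head D ` out_arcs D v) \<Longrightarrow>
     step \<sigma> (\<sigma>\<lparr>permanent := (permanent \<sigma>)(v := permanent \<sigma> v @ [x]),
       queue := remove1 (v, x) (queue \<sigma>), control := Rebuild ws\<rparr>)"
| rebuild_end:
    "control \<sigma> = Rebuild [] \<Longrightarrow>
     step \<sigma> (\<sigma>\<lparr>control := Select\<rparr>)"
| rebuild_next:
    "control \<sigma> = Rebuild (w # ws) \<Longrightarrow> distinct as \<Longrightarrow> set as = in_arcs D w \<Longrightarrow>
     step \<sigma> (\<sigma>\<lparr>control := Scan w as None ws\<rparr>)"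
| scan_exhausted:
    "control \<sigma> = Scan w (a # as) b ws \<Longrightarrow>
     last_processed \<sigma> a \<ge> length (permanent \<sigma> (tail D a)) \<Longrightarrow>
     step \<sigma> (\<sigma>\<lparr>control := Scan w as b ws\<rparr>)"
| scan_discard:
    "control \<sigma> = Scan w (a # as) b ws \<Longrightarrow>
     last_processed \<sigma> a < length (permanent \<sigma> (tail D a)) \<Longrightarrow>
     discarded (permanent \<sigma>) w (extension (permanent \<sigma>) a (last_processed \<sigma> a)) \<Longrightarrow>
     step \<sigma> (\<sigma>\<lparr>last_processed := (last_processed \<sigma>)(a := Suc (last_processed \<sigma> a))\<rparr>)"
| scan_candidate:
    "control \<sigma> = Scan w (a # as) b ws \<Longrightarrow>
     last_processed \<sigma> a < length (permanent \<sigma> (tail D a)) \<Longrightarrow>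
     y = extension (permanent \<sigma>) a (last_processed \<sigma> a) \<Longrightarrow>
     \<not> discarded (permanent \<sigma>) w y \<Longrightarrow>
     step \<sigma> (\<sigma>\<lparr>control := Scan w as (better_candidate b y) ws\<rparr>)"
| scan_end:
    "control \<sigma> = Scan w [] b ws \<Longrightarrow>
     step \<sigma> (\<sigma>\<lparr>queue := replace_candidate w b (queue \<sigma>), control := Rebuild ws\<rparr>)"
| trace_arc:
    "control \<sigma> = Trace x q \<Longrightarrow> label_pred x = Some (a, k) \<Longrightarrow>
     step \<sigma> (\<sigma>\<lparr>control := Trace (permanent \<sigma> (tail D a) ! k) (a # q)\<rparr>)"
| trace_end:
    "control \<sigma> = Trace x q \<Longrightarrow> label_pred x = None \<Longrightarrow>
     step \<sigma> (\<sigma>\<lparr>control := Done (Some (drop (length (longest_common_prefix p q)) q))\<rparr>)"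

text \<open>
  Memory is counted in cells, each holding one number, node, arc or pointer. A label takes four cells
  (two cost components, arc, position).

  Input: \<open>s\<close>, \<open>t\<close>, \<open>l\<close>; the arcs of \<open>p\<close>; for each node the heads of its lists of outgoing and
  incoming arcs; for each arc its end nodes, its two costs and the links in these two lists.
\<close>

definition input_cells :: nat where
  "input_cells = 3 + length p + 2 * card (verts D) + 6 * card (arcs D)"

text \<open>
  The iterators over neighbours are charged as if the nodes or arcs still to be visited had been
  copied.
\<close>

fun control_cells :: "('a, 'b) control \<Rightarrow> nat" where
  "control_cells Select = 1"
| "control_cells (Rebuild ws) = 1 + length ws"
| "control_cells (Scan w as b ws) = 2 + length as + (case b of None \<Rightarrow> 1 | Some x \<Rightarrow> 5) + length ws"
| "control_cells (Trace x q) = 5 + length q"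
| "control_cells (Done r) = 1 + (case r of None \<Rightarrow> 1 | Some q \<Rightarrow> 1 + length q)"

text \<open>
  Besides the labels, the list of permanent labels of each node takes two cells (address and length);
  the queue holds node-label pairs and, for each node, the position of its entry.
\<close>

definition cells :: "('a, 'b) bda_state \<Rightarrow> nat" where
  "cells \<sigma> = input_cells
    + (\<Sum>v\<in>verts D. 2 + 4 * length (permanent \<sigma> v))
    + (card (verts D) + 5 * length (queue \<sigma>))
    + card (arcs D)
    + control_cells (control \<sigma>)"

text \<open>The memory used is the largest amount occupied at any time of any run.\<close>

definition memory :: enat where
  "memory = (SUP \<sigma>\<in>{\<sigma>. step\<^sup>*\<^sup>* init \<sigma>}. enat (cells \<sigma>))"

end

definition path_arc_cost :: "('b \<Rightarrow> real) \<Rightarrow> 'b list \<Rightarrow> 'b \<Rightarrow> real \<times> real" where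
  "path_arc_cost c p a = (c a, if a \<in> set p then 1 else 0)"

definition shortest_path ::
    "('a, 'b) pre_digraph \<Rightarrow> ('b \<Rightarrow> real) \<Rightarrow> 'a \<Rightarrow> 'b list \<Rightarrow> 'a \<Rightarrow> bool" where
  "shortest_path D c s p t \<longleftrightarrow> pre_digraph.apath D s p t \<and>
    (\<forall>q. pre_digraph.apath D s q t \<longrightarrow> wf_digraph.awalk_cost c p \<le> wf_digraph.awalk_cost c q)"

type_synonym ('a, 'b) ssp_instance =
  "('a, 'b) pre_digraph \<times> 'a \<times> 'a \<times> ('b \<Rightarrow> real) \<times> 'b list"

definition ssp_instances :: "('a, 'b) ssp_instance set" where
  "ssp_instances = {(D, s, t, c, p).
    fin_digraph D \<and> s \<in> verts D \<and> t \<in> verts D \<and> (\<forall>a\<in>arcs D. 0 \<le> c a) \<and>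
    shortest_path D c s p t}"

definition bda_2ssp_memory :: "bool \<Rightarrow> ('a, 'b) ssp_instance \<Rightarrow> enat" where
  "bda_2ssp_memory target_pruning = (\<lambda>(D, s, t, c, p).
    bda_2ssp.memory D s t (path_arc_cost c p) (length p) p target_pruning)"

end

theory Submission
  imports Defs
begin

text \<open>
  Labels of a node become permanent in lexicographically nondecreasing order of cost, and none of
  them is weakly dominated by an earlier one, so their second cost components strictly decrease.
  A walk that returns to a node is weakly dominated by a permanent label of that node, so every
  stored label belongs to a path without repeated nodes; its second cost component is therefore an
  integer between \<open>0\<close> and \<open>\<ell>\<close>. Hence each node has at most \<open>\<ell> + 1\<close> permanent labels, while the
  queue holds at most one label per node.

  The extraction order is nondecreasing because the queue entry of a node is lexicographically
  least among the extensions into that node that have not been discarded.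
\<close>

section \<open>Lexicographic order and weak dominance of cost pairs\<close>

definition lex_le :: "real \<times> real \<Rightarrow> real \<times> real \<Rightarrow> bool" where
  "lex_le x y \<longleftrightarrow> fst x < fst y \<or> fst x = fst y \<and> snd x \<le> snd y"

lemma not_lex_less_iff: "\<not> lex_less y x \<longleftrightarrow> lex_le x y"
  by (auto simp: lex_less_def lex_le_def)

lemma lex_le_refl [simp]: "lex_le x x"
  by (simp add: lex_le_def)

lemma lex_le_trans: "lex_le x y \<Longrightarrow> lex_le y z \<Longrightarrow> lex_le x z"
  by (auto simp: lex_le_def)

lemma lex_le_add_mono: "lex_le x y \<Longrightarrow> lex_le (x + z) (y + z)"
  by (auto simp: lex_le_def)

lemma lex_le_add_nonneg: "0 \<le> fst z \<Longrightarrow> 0 \<le> snd z \<Longrightarrow> lex_le x (x + z)"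
  by (auto simp: lex_le_def)

lemma lex_le_better_candidate:
  assumes "better_candidate b y = Some z"
  shows "lex_le (label_cost z) (label_cost y)"
    and "b = Some x \<Longrightarrow> lex_le (label_cost z) (label_cost x)"
  using assms by (cases b; auto simp: lex_less_def lex_le_def split: if_splits)+

lemma better_candidate_cases: "better_candidate b y = Some y \<or> better_candidate b y = b"
  by (cases b) auto

lemma weakly_dominates_add_nonneg:
  "weakly_dominates x y \<Longrightarrow> 0 \<le> fst z \<Longrightarrow> 0 \<le> snd z \<Longrightarrow> weakly_dominates x (y + z)"
  by (auto simp: weakly_dominates_def)

lemma weakly_dominates_refl [simp]: "weakly_dominates x x"
  by (simp add: weakly_dominates_def)

text \<open>Lexicographic order already gives the first of the two inequalities of weak dominance,
  so only the second can fail.\<close>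

lemma snd_less_if_lex_le_not_dominated:
  "lex_le x y \<Longrightarrow> \<not> weakly_dominates x y \<Longrightarrow> snd y < snd x"
  by (auto simp: lex_le_def weakly_dominates_def)

lemma snd_sum_list:
  fixes xs :: "('a::comm_monoid_add \<times> 'b::comm_monoid_add) list"
  shows "snd (sum_list xs) = sum_list (map snd xs)"
  by (induction xs) auto

lemma sorted_wrt_snoc:
  "sorted_wrt R (xs @ [x]) \<longleftrightarrow> sorted_wrt R xs \<and> (\<forall>y\<in>set xs. R y x)"
  by (auto simp: sorted_wrt_append)

lemma sorted_wrt_nth_lex_le:
  assumes "sorted_wrt (\<lambda>x y. lex_le (label_cost x) (label_cost y)) xs" "i \<le> j" "j < length xs"
  shows "lex_le (label_cost (xs ! i)) (label_cost (xs ! j))"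
proof (cases "i = j")
  case False
  with assms show ?thesis
    using sorted_wrt_nth_less[of _ xs i j] by simp
qed simp

lemma distinct_map_remove1: "distinct (map f xs) \<Longrightarrow> distinct (map f (remove1 x xs))"
  by (induction xs) (auto dest!: set_remove1_subset[THEN subsetD])

section \<open>The invariant for nonnegative arc costs\<close>

locale nonneg_bda_2ssp = bda_2ssp D s t \<gamma> l p target_pruning + fin_digraph D
  for D :: "('a, 'b) pre_digraph" and s t :: 'a and \<gamma> :: "'b \<Rightarrow> real \<times> real"
    and l :: nat and p :: "'b list" and target_pruning :: bool +
  assumes source_in_verts: "s \<in> verts D"
    and fst_nonneg: "a \<in> arcs D \<Longrightarrow> 0 \<le> fst (\<gamma> a)"
    and snd_nonneg: "a \<in> arcs D \<Longrightarrow> 0 \<le> snd (\<gamma> a)"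
begin

text \<open>The arcs found by following predecessor entries back to the path without arcs. Being
  inductive, it also says that this chain ends; the bound on \<open>k\<close> keeps every entry
  inside a list.\<close>

inductive traces :: "('a \<Rightarrow> 'b label list) \<Rightarrow> 'b label \<Rightarrow> 'b list \<Rightarrow> bool" for P where
  traces_None: "label_pred x = None \<Longrightarrow> traces P x []"
| traces_Some: "label_pred x = Some (a, k) \<Longrightarrow> k < length (P (tail D a)) \<Longrightarrow>
    traces P (P (tail D a) ! k) q \<Longrightarrow> traces P x (q @ [a])"

text \<open>
  Asking for domination of the whole path by permanent labels of its earlier nodes, rather than of
  its prefixes, suffices to keep paths simple and is preserved by extension.
\<close>

definition valid_label :: "('a \<Rightarrow> 'b label list) \<Rightarrow> 'a \<Rightarrow> 'b label \<Rightarrow> bool" where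
  "valid_label P v x \<longleftrightarrow> (\<exists>q. apath s q v \<and> traces P x q \<and> label_cost x = sum_list (map \<gamma> q) \<and>
    (\<forall>u\<in>set (awalk_verts s q). u \<noteq> v \<longrightarrow>
      (\<exists>y\<in>set (P u). weakly_dominates (label_cost y) (label_cost x))))"

text \<open>Weaker than the negation of \<open>discarded\<close>: a new permanent label of
  \<open>t\<close> may dominate queue entries of other nodes, which can stay in the queue, so under
  target pruning \<open>\<not> discarded\<close> need not be preserved for them.\<close>

definition nondominated :: "('a \<Rightarrow> 'b label list) \<Rightarrow> 'a \<Rightarrow> 'b label \<Rightarrow> bool" where
  "nondominated P v x \<longleftrightarrow> (\<forall>y\<in>set (P v). \<not> weakly_dominates (label_cost y) (label_cost x))"

text \<open>All nodes are compared, since the extraction order is global.\<close>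

definition above_permanent :: "('a \<Rightarrow> 'b label list) \<Rightarrow> 'b label \<Rightarrow> bool" where
  "above_permanent P x \<longleftrightarrow> (\<forall>u. \<forall>y\<in>set (P u). lex_le (label_cost y) (label_cost x))"

text \<open>The last conjunct makes the pointers sound: positions before \<open>L a\<close> hold
  only discarded extensions, and an extension that is not discarded respects the extraction
  order.\<close>

definition labels_invariant ::
    "('a \<Rightarrow> 'b label list) \<Rightarrow> ('a \<times> 'b label) list \<Rightarrow> ('b \<Rightarrow> nat) \<Rightarrow> bool" where
  "labels_invariant P Q L \<longleftrightarrow>
    (\<forall>v. \<forall>x\<in>set (P v). valid_label P v x) \<and>
    (\<forall>v. sorted_wrt (\<lambda>x y. lex_le (label_cost x) (label_cost y)) (P v)) \<and>
    (\<forall>v. sorted_wrt (\<lambda>x y. \<not> weakly_dominates (label_cost x) (label_cost y)) (P v)) \<and>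
    distinct (map fst Q) \<and>
    (\<forall>(v, x)\<in>set Q. valid_label P v x \<and> nondominated P v x \<and> above_permanent P x) \<and>
    (\<forall>a\<in>arcs D. L a \<le> length (P (tail D a))) \<and>
    (\<forall>a\<in>arcs D. \<forall>k<length (P (tail D a)).
      discarded P (head D a) (extension P a k) \<or>
      L a \<le> k \<and> above_permanent P (extension P a k))"

text \<open>\<open>X\<close> is a set so that it can stand both for the queue entries of a node and
  for the best candidate of an unfinished scan.\<close>

definition covers :: "('a \<Rightarrow> 'b label list) \<Rightarrow> 'b label set \<Rightarrow> 'b \<Rightarrow> bool" where
  "covers P X a \<longleftrightarrow> (\<forall>k<length (P (tail D a)).
    discarded P (head D a) (extension P a k) \<or>
    (\<exists>x\<in>X. lex_le (label_cost x) (label_cost (extension P a k))))"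

text \<open>As a node has at most one queue entry, that entry is a lexicographic lower bound for all
  live extensions into \<open>w\<close>; without an entry, all of them are discarded.\<close>

definition settled :: "('a \<Rightarrow> 'b label list) \<Rightarrow> ('a \<times> 'b label) list \<Rightarrow> 'a \<Rightarrow> bool" where
  "settled P Q w \<longleftrightarrow> (\<forall>a\<in>in_arcs D w. covers P {x. (w, x) \<in> set Q} a)"

text \<open>All nodes are settled only in \<open>Select\<close>, where labels are extracted. During
  rebuilding, the nodes still on the work list are exempt, and for the node being scanned the best
  candidate covers the arcs already visited. The last two cases serve to bound the length of the
  path being output.\<close>

fun control_invariant ::
    "('a \<Rightarrow> 'b label list) \<Rightarrow> ('a \<times> 'b label) list \<Rightarrow> ('a, 'b) control \<Rightarrow> bool" where
  "control_invariant P Q Select \<longleftrightarrow> (\<forall>w. settled P Q w)"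
| "control_invariant P Q (Rebuild ws) \<longleftrightarrow>
    distinct ws \<and> set ws \<subseteq> verts D \<and> (\<forall>w. w \<notin> set ws \<longrightarrow> settled P Q w)"
| "control_invariant P Q (Scan w as b ws) \<longleftrightarrow>
    distinct ws \<and> set ws \<subseteq> verts D \<and> (\<forall>u. u \<notin> set (w # ws) \<longrightarrow> settled P Q u) \<and>
    distinct as \<and> set as \<subseteq> in_arcs D w \<and>
    (\<forall>x\<in>set_option b. valid_label P w x \<and> nondominated P w x \<and> above_permanent P x) \<and>
    (\<forall>a\<in>in_arcs D w - set as. covers P (set_option b) a)"
| "control_invariant P Q (Trace x q) \<longleftrightarrow> (\<exists>q'. traces P x q' \<and> apath s (q' @ q) t)"
| "control_invariant P Q (Done r) \<longleftrightarrow> (\<forall>q\<in>set_option r. length q \<le> card (verts D))"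

definition invariant :: "('a, 'b) bda_state \<Rightarrow> bool" where
  "invariant \<sigma> \<longleftrightarrow> labels_invariant (permanent \<sigma>) (queue \<sigma>) (last_processed \<sigma>) \<and>
    control_invariant (permanent \<sigma>) (queue \<sigma>) (control \<sigma>)"

lemma labels_invariantD:
  assumes "labels_invariant P Q L"
  shows "x \<in> set (P v) \<Longrightarrow> valid_label P v x"
    and "sorted_wrt (\<lambda>x y. lex_le (label_cost x) (label_cost y)) (P v)"
    and "sorted_wrt (\<lambda>x y. \<not> weakly_dominates (label_cost x) (label_cost y)) (P v)"
    and "distinct (map fst Q)"
    and "(v, x) \<in> set Q \<Longrightarrow> valid_label P v x"
    and "(v, x) \<in> set Q \<Longrightarrow> nondominated P v x"
    and "(v, x) \<in> set Q \<Longrightarrow> above_permanent P x"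
    and "a \<in> arcs D \<Longrightarrow> k < length (P (tail D a)) \<Longrightarrow>
      discarded P (head D a) (extension P a k) \<or> L a \<le> k \<and> above_permanent P (extension P a k)"
    and "a \<in> arcs D \<Longrightarrow> L a \<le> length (P (tail D a))"
  using assms unfolding labels_invariant_def by blast+

section \<open>Extending a simple path by one arc\<close>

lemma nondominated_if_not_discarded: "\<not> discarded P w y \<Longrightarrow> nondominated P w y"
  by (auto simp: discarded_def nondominated_def)

lemma valid_label_in_verts: "valid_label P v x \<Longrightarrow> v \<in> verts D"
  by (auto simp: valid_label_def apath_def)

text \<open>Costs are nonnegative, so whatever dominates the old path also dominates its extension.
  If the head of \<open>a\<close> were already on the path, one of its own permanent labels would
  dominate the extension, against \<open>nondom\<close>.\<close>

lemma valid_label_extension: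
  assumes a: "a \<in> arcs D" and k: "k < length (P (tail D a))"
    and valid: "valid_label P (tail D a) (P (tail D a) ! k)"
    and nondom: "nondominated P (head D a) (extension P a k)"
  shows "valid_label P (head D a) (extension P a k)"
proof -
  let ?x = "P (tail D a) ! k" and ?y = "extension P a k"
  obtain q where q: "apath s q (tail D a)" "traces P ?x q" "label_cost ?x = sum_list (map \<gamma> q)"
    and dom: "\<And>u. u \<in> set (awalk_verts s q) \<Longrightarrow> u \<noteq> tail D a \<Longrightarrow>
      \<exists>y\<in>set (P u). weakly_dominates (label_cost y) (label_cost ?x)"
    using valid unfolding valid_label_def by blast
  have cost: "label_cost ?y = label_cost ?x + \<gamma> a" and pred: "label_pred ?y = Some (a, k)"
    by (simp_all add: extension_def)
  \<comment> \<open>The tail of \<open>a\<close> was exempt in the old label; here its permanent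
    label at position \<open>k\<close> is the witness.\<close>
  have dom': "\<exists>y\<in>set (P u). weakly_dominates (label_cost y) (label_cost ?y)"
    if "u \<in> set (awalk_verts s q)" for u
  proof -
    have "\<exists>y\<in>set (P u). weakly_dominates (label_cost y) (label_cost ?x)"
      using dom[OF that] k by (cases "u = tail D a") (auto intro: bexI[of _ ?x])
    then show ?thesis
      using a by (auto simp: cost intro: weakly_dominates_add_nonneg fst_nonneg snd_nonneg)
  qed
  have fresh: "head D a \<notin> set (awalk_verts s q)"
    using dom' nondom by (auto simp: nondominated_def)
  have walk: "awalk s q (tail D a)" and "awlast s q = tail D a"
    using q(1) by (auto simp: apath_def)
  then have walk': "awalk s (q @ [a]) (head D a)"
    using a by (simp add: arc_implies_awalk)
  have verts: "awalk_verts s (q @ [a]) = awalk_verts s q @ [head D a]"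
    using awalk_verts_append[OF walk'] by simp
  have "apath s (q @ [a]) (head D a)"
    using q(1) walk' fresh by (simp add: apath_def verts)
  moreover have "traces P ?y (q @ [a])"
    using pred k q(2) by (rule traces_Some)
  moreover have "label_cost ?y = sum_list (map \<gamma> (q @ [a]))"
    by (simp add: cost q(3))
  ultimately show ?thesis
    unfolding valid_label_def using dom' by (intro exI[of _ "q @ [a]"]) (auto simp: verts)
qed

section \<open>Making a label permanent\<close>

lemma traces_permanent_snoc:
  "traces P y q \<Longrightarrow> traces (P(v := P v @ [x])) y q"
proof (induction rule: traces.induct)
  case (traces_Some y a k q)
  let ?P = "P(v := P v @ [x])"
  have "k < length (?P (tail D a))" and "?P (tail D a) ! k = P (tail D a) ! k"
    using traces_Some.hyps(2) by (auto simp: nth_append)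
  with traces_Some show ?case
    by (intro traces.traces_Some[of y a k]) auto
qed (rule traces_None)

lemma valid_label_permanent_snoc:
  "valid_label P w y \<Longrightarrow> valid_label (P(v := P v @ [x])) w y"
  unfolding valid_label_def by (fastforce intro: traces_permanent_snoc)

lemma discarded_permanent_snoc:
  "discarded P w y \<Longrightarrow> discarded (P(v := P v @ [x])) w y"
  by (auto simp: discarded_def)

lemma extension_permanent_snoc:
  "k < length (P (tail D a)) \<Longrightarrow> extension (P(v := P v @ [x])) a k = extension P a k"
  by (auto simp: extension_def nth_append)

lemma above_permanent_snoc_iff:
  "above_permanent (P(v := P v @ [x])) y \<longleftrightarrow>
    above_permanent P y \<and> lex_le (label_cost x) (label_cost y)"
  unfolding above_permanent_def by (auto split: if_splits)

lemma above_permanent_trans: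
  "above_permanent P x \<Longrightarrow> lex_le (label_cost x) (label_cost y) \<Longrightarrow> above_permanent P y"
  by (auto simp: above_permanent_def intro: lex_le_trans)

text \<open>Every live old extension lies above some queue entry, hence above the least one,
  \<open>x\<close>; extensions of \<open>x\<close> itself lie above \<open>x\<close> because arc
  costs are nonnegative. So nothing below \<open>x\<close> can be extracted later.\<close>

lemma labels_invariant_permanent:
  assumes inv: "labels_invariant P Q L" and settled: "\<And>w. settled P Q w"
    and x: "(v, x) \<in> set Q"
    and least: "\<And>w y. (w, y) \<in> set Q \<Longrightarrow> lex_le (label_cost x) (label_cost y)"
  shows "labels_invariant (P(v := P v @ [x])) (remove1 (v, x) Q) L"
proof -
  let ?P = "P(v := P v @ [x])" and ?Q = "remove1 (v, x) Q"
  note I = labels_invariantD[OF inv]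
  have Q: "distinct Q" and dQ: "distinct (map fst ?Q)"
    using I(4) distinct_map_remove1[of fst Q] by (auto simp: distinct_map[of fst Q])
  \<comment> \<open>The queue has one entry per node, so removing that of \<open>v\<close> leaves
    only other nodes, whose permanent lists do not change.\<close>
  have Qv: "w \<noteq> v" "(w, y) \<in> set Q" if "(w, y) \<in> set ?Q" for w y
    using that x Q eq_key_imp_eq_value[OF I(4)] by auto
  have valid: "valid_label ?P w y" if "y \<in> set (?P w)" for w y
    using that I(1,5) x by (auto intro!: valid_label_permanent_snoc split: if_splits)
  have above: "above_permanent P x" and nd: "nondominated P v x"
    using I(6,7) x by auto
  have queue: "valid_label ?P w y \<and> nondominated ?P w y \<and> above_permanent ?P y"
    if "(w, y) \<in> set ?Q" for w y
    using Qv[OF that] I(5-7)[of w y] least[of w y]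
    by (auto simp: above_permanent_snoc_iff nondominated_def intro: valid_label_permanent_snoc)
  have ext: "discarded ?P (head D a) (extension ?P a k) \<or>
      L a \<le> k \<and> above_permanent ?P (extension ?P a k)"
    if a: "a \<in> arcs D" and k: "k < length (?P (tail D a))" for a k
  proof (cases "k < length (P (tail D a))")
    case True
    have "covers P {x. (head D a, x) \<in> set Q} a"
      using settled a by (auto simp: settled_def)
    then consider "discarded P (head D a) (extension P a k)"
      | y where "(head D a, y) \<in> set Q" "lex_le (label_cost y) (label_cost (extension P a k))"
      using True by (auto simp: covers_def)
    then show ?thesis
    proof cases
      case 1
      then show ?thesis
        using True by (simp add: discarded_permanent_snoc extension_permanent_snoc)
    next
      case 2
      then have "lex_le (label_cost x) (label_cost (extension P a k))"
        using least lex_le_trans by blast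
      then show ?thesis
        using I(8)[OF a True]
        by (auto simp: True above_permanent_snoc_iff extension_permanent_snoc
            intro: discarded_permanent_snoc)
    qed
  next
    case False
    \<comment> \<open>The only new position is that of \<open>x\<close> itself. The old length
      bounds \<open>L a\<close>, so the pointer has not passed it.\<close>
    then have v: "tail D a = v" and k': "k = length (P v)"
      using k by (auto split: if_splits)
    have x_le: "lex_le (label_cost x) (label_cost (extension ?P a k))"
      using a by (simp add: extension_def v k' lex_le_add_nonneg fst_nonneg snd_nonneg)
    then show ?thesis
      using above I(9)[OF a]
      by (auto simp: above_permanent_snoc_iff v k' intro: above_permanent_trans)
  qed
  have "L a \<le> length (?P (tail D a))" if "a \<in> arcs D" for a
    using I(9)[OF that] by auto
  moreover have "sorted_wrt (\<lambda>x y. lex_le (label_cost x) (label_cost y)) (?P w)"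
    "sorted_wrt (\<lambda>x y. \<not> weakly_dominates (label_cost x) (label_cost y)) (?P w)" for w
    using I(2,3) above nd by (auto simp: sorted_wrt_snoc above_permanent_def nondominated_def)
  ultimately show ?thesis
    unfolding labels_invariant_def using valid dQ queue ext by blast
qed

text \<open>New extensions arise only along arcs leaving \<open>v\<close>, and only the entry of
  \<open>v\<close> leaves the queue; hence exactly \<open>v\<close> and its out-neighbours go on the
  work list.\<close>

lemma settled_permanent:
  assumes settled: "settled P Q w" and w: "w \<noteq> v" "w \<notin> head D ` out_arcs D v"
  shows "settled (P(v := P v @ [x])) (remove1 (v, x) Q) w"
  unfolding settled_def covers_def
proof (intro ballI allI impI)
  fix a k
  let ?P = "P(v := P v @ [x])"
  assume a: "a \<in> in_arcs D w" and k: "k < length (?P (tail D a))"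
  have "tail D a \<noteq> v"
    using a w(2) by (auto simp: out_arcs_def)
  then have k': "k < length (P (tail D a))"
    using k by simp
  then have "discarded P (head D a) (extension P a k) \<or>
      (\<exists>x\<in>{x. (w, x) \<in> set Q}. lex_le (label_cost x) (label_cost (extension P a k)))"
    using settled a by (auto simp: settled_def covers_def)
  moreover have "(w, y) \<in> set (remove1 (v, x) Q)" if "(w, y) \<in> set Q" for y
    using that w(1) by (simp add: in_set_remove1)
  ultimately show "discarded ?P (head D a) (extension ?P a k) \<or>
      (\<exists>x\<in>{y. (w, y) \<in> set (remove1 (v, x) Q)}.
        lex_le (label_cost x) (label_cost (extension ?P a k)))"
    using extension_permanent_snoc[of k P a v x] k' discarded_permanent_snoc by auto
qed

section \<open>Discarding extensions and updating the queue\<close>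

lemma labels_invariant_remove1:
  "labels_invariant P Q L \<Longrightarrow> labels_invariant P (remove1 e Q) L"
  unfolding labels_invariant_def
  by (auto dest: notin_set_remove1 intro: distinct_map_remove1)

lemma labels_invariant_discard:
  assumes inv: "labels_invariant P Q L"
    and L: "L a < length (P (tail D a))"
    and disc: "discarded P (head D a) (extension P a (L a))"
  shows "labels_invariant P Q (L(a := Suc (L a)))"
proof -
  have "discarded P (head D a) (extension P a k) \<or> Suc (L a) \<le> k \<and> above_permanent P (extension P a k)"
    if "a \<in> arcs D" "k < length (P (tail D a))" for k
    using labels_invariantD(8)[OF inv that] disc by (cases "k = L a") auto
  then show ?thesis
    using inv L unfolding labels_invariant_def by auto
qed

lemma set_replace_candidate:
  "(u, x) \<in> set (replace_candidate w b Q) \<longleftrightarrow>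
    (if u = w then x \<in> set_option b else (u, x) \<in> set Q)"
  by (auto simp: replace_candidate_def split: option.splits)

lemma distinct_replace_candidate:
  "distinct (map fst Q) \<Longrightarrow> distinct (map fst (replace_candidate w b Q))"
  by (auto simp: replace_candidate_def distinct_map inj_on_def split: option.splits)

lemma labels_invariant_replace_candidate:
  assumes "labels_invariant P Q L"
    and "\<And>x. x \<in> set_option b \<Longrightarrow>
      valid_label P w x \<and> nondominated P w x \<and> above_permanent P x"
  shows "labels_invariant P (replace_candidate w b Q) L"
  using assms unfolding labels_invariant_def
  by (auto simp: set_replace_candidate distinct_replace_candidate split: if_splits)

lemma settled_replace_candidate:
  "settled P (replace_candidate w b Q) u \<longleftrightarrow>
    (if u = w then \<forall>a\<in>in_arcs D w. covers P (set_option b) a else settled P Q u)"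
  by (auto simp: settled_def set_replace_candidate simp flip: elem_set)

section \<open>Scanning the incoming arcs of a node\<close>

lemma covers_better_candidate:
  assumes "covers P (set_option b) a"
  shows "covers P (set_option (better_candidate b y)) a"
proof (cases b)
  case None
  with assms show ?thesis by (auto simp: covers_def)
next
  case (Some x)
  obtain z where z: "better_candidate b y = Some z"
    using Some by simp
  have "lex_le (label_cost z) (label_cost x)"
    using lex_le_better_candidate(2)[OF z Some] .
  with assms show ?thesis
    unfolding covers_def z unfolding Some by (auto intro: lex_le_trans)
qed

text \<open>No position is left at or beyond the pointer, so the invariant leaves only discarded
  extensions, and any \<open>X\<close> will do.\<close>

lemma covers_exhausted:
  assumes "labels_invariant P Q L" "a \<in> arcs D" "length (P (tail D a)) \<le> L a"
  shows "covers P X a"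
  using labels_invariantD(8)[OF assms(1,2)] assms(3) by (force simp: covers_def)

text \<open>Permanent labels at the tail are sorted, and adding the cost of \<open>a\<close>
  preserves the order. So the extension at the pointer is least among those from there on, and one
  candidate per arc suffices.\<close>

lemma covers_first_extension:
  assumes inv: "labels_invariant P Q L" and a: "a \<in> arcs D"
    and y: "y = extension P a (L a)"
  shows "covers P (set_option (better_candidate b y)) a"
proof -
  obtain z where z: "better_candidate b y = Some z"
    by (cases b) auto
  have le: "lex_le (label_cost z) (label_cost y)"
    using lex_le_better_candidate(1)[OF z] .
  have "lex_le (label_cost z) (label_cost (extension P a k))"
    if "L a \<le> k" "k < length (P (tail D a))" for k
    using sorted_wrt_nth_lex_le[OF labels_invariantD(2)[OF inv] that] le
    by (auto simp: y extension_def intro: lex_le_trans lex_le_add_mono)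
  then show ?thesis
    using labels_invariantD(8)[OF inv a] by (fastforce simp: covers_def z)
qed

lemma length_le_if_distinct_verts: "distinct ws \<Longrightarrow> set ws \<subseteq> verts D \<Longrightarrow> length ws \<le> card (verts D)"
  by (metis card_mono distinct_card finite_verts)

section \<open>Preservation of the invariant along runs\<close>

lemma invariant_init: "invariant init"
  using source_in_verts
  by (auto simp: invariant_def init_def labels_invariant_def settled_def covers_def valid_label_def
      nondominated_def above_permanent_def apath_Nil_iff intro!: exI[of _ "[]"] traces_None)

lemma invariant_step:
  assumes "step \<sigma> \<tau>" "invariant \<sigma>"
  shows "invariant \<tau>"
  using assms
proof (induction rule: step.induct)
  case (empty_queue \<sigma>)
  then show ?case by (auto simp: invariant_def)
next
  case (found \<sigma> v x)
  let ?P = "permanent \<sigma>" and ?Q = "queue \<sigma>"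
  have inv: "labels_invariant ?P ?Q (last_processed \<sigma>)"
    using found by (simp add: invariant_def)
  \<comment> \<open>Tracing starts with no arcs collected, so the remaining part is the whole simple
    path of this label.\<close>
  have "valid_label ?P t x"
    using labels_invariantD(5)[OF inv, of t x] found by (auto simp: lex_min_in_queue_def)
  then show ?case
    using labels_invariant_remove1[OF inv] by (auto simp: invariant_def valid_label_def)
next
  case (permanent \<sigma> v x ws)
  let ?P = "permanent \<sigma>" and ?Q = "queue \<sigma>"
  have inv: "labels_invariant ?P ?Q (last_processed \<sigma>)" and settled: "\<And>w. settled ?P ?Q w"
    using permanent by (auto simp: invariant_def)
  have x: "(v, x) \<in> set ?Q"
    and least: "\<And>w y. (w, y) \<in> set ?Q \<Longrightarrow> lex_le (label_cost x) (label_cost y)"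
    using permanent.hyps(2) by (auto simp: lex_min_in_queue_def not_lex_less_iff)
  have "v \<in> verts D"
    using labels_invariantD(5)[OF inv x] valid_label_in_verts by blast
  then have "set ws \<subseteq> verts D"
    unfolding permanent.hyps(5) by auto
  then show ?case
    using permanent.hyps(4,5) labels_invariant_permanent[OF inv settled x least]
      settled_permanent[OF settled]
    by (simp add: invariant_def)
next
  case (rebuild_end \<sigma>)
  then show ?case by (auto simp: invariant_def)
next
  case (rebuild_next \<sigma> w ws as)
  then show ?case by (simp add: invariant_def)
next
  case (scan_exhausted \<sigma> w a as b ws)
  let ?P = "permanent \<sigma>"
  have "a \<in> in_arcs D w" "labels_invariant ?P (queue \<sigma>) (last_processed \<sigma>)"
    using scan_exhausted by (auto simp: invariant_def)
  then have "covers ?P (set_option b) a"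
    using covers_exhausted scan_exhausted.hyps(2) by auto
  then show ?case
    using scan_exhausted by (auto simp: invariant_def)
next
  case (scan_discard \<sigma> w a as b ws)
  have "head D a = w"
    using scan_discard by (auto simp: invariant_def)
  then show ?case
    using scan_discard labels_invariant_discard by (auto simp: invariant_def)
next
  case (scan_candidate \<sigma> w a as b ws y)
  let ?P = "permanent \<sigma>"
  have inv: "labels_invariant ?P (queue \<sigma>) (last_processed \<sigma>)"
    and ctrl: "control_invariant ?P (queue \<sigma>) (Scan w (a # as) b ws)"
    using scan_candidate by (auto simp: invariant_def)
  then have a: "a \<in> arcs D" "head D a = w"
    by auto
  note y = scan_candidate.hyps(3) and k = scan_candidate.hyps(2)
  have nd: "nondominated ?P w y"
    using scan_candidate.hyps(4) by (rule nondominated_if_not_discarded)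
  have "valid_label ?P (tail D a) (?P (tail D a) ! last_processed \<sigma> a)"
    using labels_invariantD(1)[OF inv] k by simp
  then have "valid_label ?P w y"
    using valid_label_extension[of a "last_processed \<sigma> a" ?P] a k nd y by simp
  moreover have "above_permanent ?P y"
    using labels_invariantD(8)[OF inv a(1) k] scan_candidate.hyps(4) a(2) y by auto
  ultimately have
    "\<forall>x\<in>set_option (better_candidate b y). valid_label ?P w x \<and> nondominated ?P w x \<and> above_permanent ?P x"
    using nd ctrl better_candidate_cases[of b y] by auto
  \<comment> \<open>For arcs scanned earlier, the best candidate can only decrease; the arc
    \<open>a\<close> itself is covered by its first live extension.\<close>
  moreover have "covers ?P (set_option (better_candidate b y)) a'"
    if "a' \<in> in_arcs D w - set as" for a'
    using that ctrl covers_first_extension[OF inv a(1) y] covers_better_candidate[of ?P b a' y]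
    by (cases "a' = a") auto
  ultimately show ?case
    using inv ctrl by (auto simp: invariant_def)
next
  case (scan_end \<sigma> w b ws)
  then show ?case
    by (auto simp: invariant_def settled_replace_candidate intro: labels_invariant_replace_candidate)
next
  case (trace_arc \<sigma> x q a k)
  then obtain q' where "traces (permanent \<sigma>) x q'" "apath s (q' @ q) t"
    by (auto simp: invariant_def)
  moreover from this(1) obtain q'' where "q' = q'' @ [a]"
    "traces (permanent \<sigma>) (permanent \<sigma> (tail D a) ! k) q''"
    using trace_arc.hyps(2) by (auto elim: traces.cases)
  ultimately show ?case
    using trace_arc by (auto simp: invariant_def)
next
  case (trace_end \<sigma> x q)
  then obtain q' where "traces (permanent \<sigma>) x q'" "apath s (q' @ q) t"
    by (auto simp: invariant_def)
  then have "length q \<le> card (verts D)"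
    using length_apath_less[of s "q' @ q" t] by simp
  then show ?case
    using trace_end by (auto simp: invariant_def)
qed

lemma invariant_reachable: "step\<^sup>*\<^sup>* init \<sigma> \<Longrightarrow> invariant \<sigma>"
  by (induction rule: rtranclp_induct) (auto intro: invariant_init invariant_step)

section \<open>Size of the queue and of the control state\<close>

lemma length_queue_le:
  assumes "labels_invariant P Q L"
  shows "length Q \<le> card (verts D)"
proof -
  have "set (map fst Q) \<subseteq> verts D"
    using labels_invariantD(5)[OF assms] valid_label_in_verts by fastforce
  then show ?thesis
    using length_le_if_distinct_verts[OF labels_invariantD(4)[OF assms]] by simp
qed

text \<open>The constant 7 comes from \<open>Scan\<close>: two cells plus five for a candidate. In
  \<open>Trace\<close>, the collected arcs are part of a simple path.\<close>

lemma control_cells_le: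
  assumes "control_invariant P Q c"
  shows "control_cells c \<le> 7 + card (verts D) + card (arcs D)"
proof (cases c)
  case (Rebuild ws)
  then show ?thesis
    using assms length_le_if_distinct_verts[of ws] by simp
next
  case (Scan w as b ws)
  then have "length as \<le> card (arcs D)"
    using assms by (metis control_invariant.simps(3) card_mono distinct_card finite_arcs
        in_arcs_in_arcs subset_iff)
  then show ?thesis
    using Scan assms length_le_if_distinct_verts[of ws] by (auto split: option.splits)
next
  case (Trace x q)
  then show ?thesis
    using assms length_apath_less[of s _ t] by fastforce
next
  case (Done r)
  then show ?thesis
    using assms by (auto split: option.splits)
qed simp

end

section \<open>Counting permanent labels\<close>

locale path_counting_bda_2ssp = nonneg_bda_2ssp +
  assumes snd_arc_cost: "a \<in> arcs D \<Longrightarrow> snd (\<gamma> a) = (if a \<in> set p then 1 else 0)"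
begin

text \<open>A simple path repeats no arc, so its second cost is the number of its arcs that lie on
  \<open>p\<close>.\<close>

lemma valid_label_snd:
  assumes "valid_label P v x"
  shows "snd (label_cost x) \<in> real ` {..length p}"
proof -
  obtain q where q: "apath s q v" "label_cost x = sum_list (map \<gamma> q)"
    using assms by (auto simp: valid_label_def)
  have arcs: "set q \<subseteq> arcs D" and "distinct q"
    using q(1) by (auto simp: apath_def dest: distinct_verts_imp_distinct)
  have "snd (label_cost x) = (\<Sum>a\<leftarrow>q. if a \<in> set p then 1 else 0)"
    unfolding q(2) snd_sum_list map_map using arcs
    by (intro arg_cong[where f = sum_list] map_cong) (auto simp: snd_arc_cost)
  also have "\<dots> = real (length (filter (\<lambda>a. a \<in> set p) q))"
    by (induction q) auto
  finally have snd: "snd (label_cost x) = real (length (filter (\<lambda>a. a \<in> set p) q))" .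
  have "length (filter (\<lambda>a. a \<in> set p) q) = card (set (filter (\<lambda>a. a \<in> set p) q))"
    using \<open>distinct q\<close> by (simp add: distinct_card del: set_filter)
  also have "\<dots> \<le> card (set p)"
    by (intro card_mono) auto
  also have "\<dots> \<le> length p"
    by (rule card_length)
  finally show ?thesis
    by (simp add: snd)
qed

text \<open>Second costs strictly decrease along the list, so positions map injectively into the
  \<open>length p + 1\<close> integers from 0 to \<open>length p\<close>.\<close>

lemma length_permanent_le:
  assumes inv: "labels_invariant P Q L"
  shows "length (P v) \<le> length p + 1"
proof -
  let ?f = "\<lambda>i. snd (label_cost (P v ! i))"
  have less: "?f j < ?f i" if "i < j" "j < length (P v)" for i j
    using that labels_invariantD(2,3)[OF inv, of v]
    by (auto simp: sorted_wrt_iff_nth_less intro: snd_less_if_lex_le_not_dominated)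
  have inj: "inj_on ?f {..<length (P v)}"
  proof (rule inj_onI)
    fix i j assume "i \<in> {..<length (P v)}" "j \<in> {..<length (P v)}" "?f i = ?f j"
    then show "i = j"
      using less[of i j] less[of j i] by (cases i j rule: linorder_cases) auto
  qed
  have "?f ` {..<length (P v)} \<subseteq> real ` {..length p}"
    using valid_label_snd labels_invariantD(1)[OF inv] by (metis image_subsetI lessThan_iff nth_mem)
  from card_inj_on_le[OF inj this] have "length (P v) \<le> card (real ` {..length p})"
    by simp
  also have "\<dots> = length p + 1"
    by (simp add: card_image)
  finally show ?thesis .
qed

section \<open>The explicit memory bound\<close>

lemma cells_le:
  assumes "invariant \<sigma>" and p: "length p < card (verts D)"
  shows "cells \<sigma> \<le> 28 * (card (verts D) * length p + card (verts D) + card (arcs D))"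
proof -
  let ?n = "card (verts D)" and ?m = "card (arcs D)"
  have inv: "labels_invariant (permanent \<sigma>) (queue \<sigma>) (last_processed \<sigma>)"
    and ctrl: "control_invariant (permanent \<sigma>) (queue \<sigma>) (control \<sigma>)"
    using assms by (auto simp: invariant_def)
  define S where "S = (\<Sum>v\<in>verts D. 2 + 4 * length (permanent \<sigma> v))"
  have "S \<le> (\<Sum>v\<in>verts D. 6 + 4 * length p)"
    unfolding S_def
  proof (rule sum_mono)
    fix v
    show "2 + 4 * length (permanent \<sigma> v) \<le> 6 + 4 * length p"
      using length_permanent_le[OF inv, of v] by simp
  qed
  also have "\<dots> = 6 * ?n + 4 * (?n * length p)"
    by (simp add: algebra_simps)
  finally have "S \<le> 6 * ?n + 4 * (?n * length p)" .
  \<comment> \<open>The summands add up to at most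
    \<open>4 * (?n * length p) + 15 * ?n + 8 * ?m + length p + 10\<close>. Since
    \<open>length p < ?n\<close>, also \<open>?n\<close> is at least 1, so
    \<open>length p + 10\<close> is at most \<open>10 * ?n\<close>; the constant 28 leaves
    slack.\<close>
  then show ?thesis
    using length_queue_le[OF inv] control_cells_le[OF ctrl] p
    unfolding cells_def input_cells_def S_def[symmetric] distrib_left by linarith
qed

lemma memory_le:
  assumes "length p < card (verts D)"
  shows "memory \<le> enat (28 * (card (verts D) * length p + card (verts D) + card (arcs D)))"
  unfolding memory_def
  by (rule SUP_least) (simp only: mem_Collect_eq enat_ord_simps cells_le[OF invariant_reachable assms])

end

section \<open>Asymptotic bounds over all instances\<close>

lemma ssp_instance_path_length:
  assumes "(D, s, t, c, p) \<in> ssp_instances"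
  shows "length p < card (verts D)"
proof -
  interpret fin_digraph D
    using assms by (simp add: ssp_instances_def)
  show ?thesis
    using assms length_apath_less by (auto simp: ssp_instances_def shortest_path_def)
qed

lemma bda_2ssp_memory_le:
  assumes "(D, s, t, c, p) \<in> ssp_instances"
  shows "bda_2ssp_memory target_pruning (D, s, t, c, p)
    \<le> enat (28 * (card (verts D) * length p + card (verts D) + card (arcs D)))"
proof -
  interpret fin_digraph D
    using assms by (simp add: ssp_instances_def)
  interpret path_counting_bda_2ssp D s t "path_arc_cost c p" "length p" p target_pruning
    using assms by unfold_locales (auto simp: ssp_instances_def path_arc_cost_def)
  show ?thesis
    using memory_le ssp_instance_path_length[OF assms] by (simp add: bda_2ssp_memory_def)
qed

text \<open>Finiteness is stated separately because \<open>the_enat\<close> is unspecified at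
  infinity. The principal filter makes the constants uniform: the bounds hold for every instance,
  not just for large ones.\<close>

theorem theorem5:
  fixes target_pruning :: bool
  shows "(\<forall>I\<in>(ssp_instances :: ('a, 'b) ssp_instance set). bda_2ssp_memory target_pruning I \<noteq> \<infinity>) \<and>
    (\<lambda>I. real (the_enat (bda_2ssp_memory target_pruning I)))
      \<in> O[principal (ssp_instances :: ('a, 'b) ssp_instance set)](\<lambda>(D, s, t, c, p).
          real (card (verts D) * length p + card (verts D) + card (arcs D))) \<and>
    O[principal (ssp_instances :: ('a, 'b) ssp_instance set)](\<lambda>(D, s, t, c, p).
          real (card (verts D) * length p + card (verts D) + card (arcs D)))
      \<subseteq> O[principal (ssp_instances :: ('a, 'b) ssp_instance set)](\<lambda>(D, s, t, c, p).
          real ((card (verts D))\<^sup>2 + card (arcs D)))"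
proof (intro conjI ballI)
  fix I :: "('a, 'b) ssp_instance"
  obtain D s t c p where I: "I = (D, s, t, c, p)"
    by (cases I)
  assume "I \<in> ssp_instances"
  then show "bda_2ssp_memory target_pruning I \<noteq> \<infinity>"
    using bda_2ssp_memory_le[of D s t c p target_pruning] unfolding I by (auto dest: enat_ile)
next
  have "real (the_enat (bda_2ssp_memory target_pruning (D, s, t, c, p)))
      \<le> 28 * real (card (verts D) * length p + card (verts D) + card (arcs D))"
    if I: "(D, s, t, c, p) \<in> ssp_instances" for D :: "('a, 'b) pre_digraph" and s t c p
  proof -
    let ?b = "28 * (card (verts D) * length p + card (verts D) + card (arcs D))"
    have "the_enat (bda_2ssp_memory target_pruning (D, s, t, c, p)) \<le> ?b"
      using bda_2ssp_memory_le[OF I, of target_pruning] by (metis enat_ile enat_ord_simps(1) the_enat.simps)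
    then have "real (the_enat (bda_2ssp_memory target_pruning (D, s, t, c, p))) \<le> real ?b"
      by (rule of_nat_mono)
    then show ?thesis by simp
  qed
  then show "(\<lambda>I. real (the_enat (bda_2ssp_memory target_pruning I)))
      \<in> O[principal (ssp_instances :: ('a, 'b) ssp_instance set)](\<lambda>(D, s, t, c, p).
          real (card (verts D) * length p + card (verts D) + card (arcs D)))"
    by (intro bigoI[where c = 28]) (auto simp: eventually_principal simp del: of_nat_add of_nat_mult)
next
  have "card (verts D) * length p + card (verts D) + card (arcs D) \<le> (card (verts D))\<^sup>2 + card (arcs D)"
    if "(D, s, t, c, p) \<in> ssp_instances" for D :: "('a, 'b) pre_digraph" and s t c p
  proof -
    \<comment> \<open>The strict inequality between \<open>length p\<close> and the number of nodes
      leaves room for the linear summand inside the square.\<close>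
    have "card (verts D) * Suc (length p) \<le> card (verts D) * card (verts D)"
      using ssp_instance_path_length[OF that] by (intro mult_le_mono) auto
    then show ?thesis by (simp add: power2_eq_square)
  qed
  then have "(\<lambda>(D, s, t, c, p). real (card (verts D) * length p + card (verts D) + card (arcs D)))
      \<in> O[principal (ssp_instances :: ('a, 'b) ssp_instance set)](\<lambda>(D, s, t, c, p).
          real ((card (verts D))\<^sup>2 + card (arcs D)))"
    by (intro bigoI[where c = 1])
      (fastforce simp: eventually_principal simp del: of_nat_add of_nat_mult of_nat_power)
  then show "O[principal (ssp_instances :: ('a, 'b) ssp_instance set)](\<lambda>(D, s, t, c, p).
          real (card (verts D) * length p + card (verts D) + card (arcs D)))
      \<subseteq> O[principal (ssp_instances :: ('a, 'b) ssp_instance set)](\<lambda>(D, s, t, c, p).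
          real ((card (verts D))\<^sup>2 + card (arcs D)))"
    by (rule landau_o.big.subsetI)
qed

end
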